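(* Let $(M,d)$ be a proper metric space and let $G$ be a locally compact Hausdorff group acting continuously, properly, isometrically and transitively on $M$. Suppose the metric $G$-space $M$ has Property (S). Fix a base point $* \in M$, let $K$ be the (compact) isotropy subgroup of $G$ at $*$, let $K\backslash M$ be the space of $K$-orbits in $M$ equipped with the proper metric $d^K$, and define $\mu : G \to K\backslash M$ by $\mu(g) := K\cdot(g\cdot * )$. Let $H_1$ and $H_2$ be non-empty subsets of $G$. (1) The pair $(H_1,H_2)$ is proper in $G$ if and only if the pair $(\mu(H_1),\mu(H_2))$ is HBI in $K\backslash M$, that is, for any $r\ge 0$ the intersection $\mu(H_1)\cap \overline{N}_r(\mu(H_2))$ is bounded in the proper metric space $K\backslash M$. (2) The following four conditions on $(H_1,H_2)$ are equivalent: (2-a) $H_1\sim H_2$ in $G$. (2-b) $\mu(H_1)\sim\mu(H_2)$ in $K\backslash M$. (2-c) $\pitchfork(H_1:G)=\pitchfork(H_2:G)$. (2-d) $\mathcal{HBI}(\mu(H_1):K\backslash M)=\mathcal{HBI}(\mu(H_2):K\backslash M)$.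
   Context: Proper metric space: a metric space in which every closed ball is compact. A continuous action of a locally compact group $H$ on a locally compact Hausdorff space $X$ is proper if for every compact $D\subset X$ the set $\{h\in H \mid (h\cdot D)\cap D\neq\emptyset\}$ is compact. Property (S) for a metric $G$-space $M$: for each $r\ge 0$ there exists $\tau(r)\ge 0$ such that for any $p_0,p,q\in M$ with $d(p,p_0)\le r$ one can choose $g\in G$ with $g\cdot p=p_0$ and $d(q,g\cdot q)\le\tau(r)$. Metric on $K\backslash M$: $d^K(\mathcal{O}_1,\mathcal{O}_2):=\min\{d(x,y)\mid (x,y)\in\mathcal{O}_1\times\mathcal{O}_2\}$. In the group $G$: for $H\subset G$ and compact $D\subset G$ put $\overline{N}_D(H):=D\cdot H\cdot D^{-1}$. For non-empty $H_1,H_2\subset G$, $H_1\sim H_2$ in $G$ means there is a compact $D\subset G$ with $H_1\subset\overline{N}_D(H_2)$ and $H_2\subset\overline{N}_D(H_1)$; this is an equivalence relation on the non-empty subsets of $G$, with classes denoted $[H]$. The pair $(H_1,H_2)$ is proper in $G$ (written $H_1\pitchfork H_2$ in $G$) if for all $H_1'\in[H_1]$, $H_2'\in[H_2]$ the intersection $H_1'\cap H_2'$ is relatively compact in $G$. $\pitchfork(H:G)$ is the set of all non-empty $H'\subset G$ with $H\pitchfork H'$ in $G$. In a proper metric space $(X,d_X)$: $\overline{N}_r(C):=\{p\in X\mid d_X(p,c)\le r\text{ for some }c\in C\}$. For non-empty $C_1,C_2\subset X$, $C_1\sim C_2$ in $X$ means there is $r\ge0$ with $C_1\subset\overline{N}_r(C_2)$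 and $C_2\subset\overline{N}_r(C_1)$; classes are denoted $[C]$. The pair $(C_1,C_2)$ is HBI in $X$ if for all $C_1'\in[C_1]$, $C_2'\in[C_2]$ the intersection $C_1'\cap C_2'$ is bounded in $X$. $\mathcal{HBI}(C:X)$ is the set of all non-empty $C'\subset X$ such that $(C,C')$ is HBI in $X$. *)

theory Defs
  imports "HOL-Analysis.Analysis" "HOL-Algebra.Group_Action"
begin

section \<open>Topological groups and their actions on metric spaces\<close>

locale topological_group = group G
  for G :: "('g, 'e) monoid_scheme" (structure) and T :: "'g topology" +
  assumes topspace_eq_carrier: "topspace T = carrier G"
    and continuous_mult: "continuous_map (prod_topology T T) T (\<lambda>(g, h). g \<otimes> h)"
    and continuous_inv: "continuous_map T T (\<lambda>g. inv g)"

definition continuous_action ::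
    "'g topology \<Rightarrow> 'm topology \<Rightarrow> ('g \<Rightarrow> 'm \<Rightarrow> 'm) \<Rightarrow> bool" where
  "continuous_action T X \<phi> \<longleftrightarrow> continuous_map (prod_topology T X) X (\<lambda>(g, x). \<phi> g x)"

definition proper_action ::
    "('g, 'e) monoid_scheme \<Rightarrow> 'g topology \<Rightarrow> 'm topology \<Rightarrow> ('g \<Rightarrow> 'm \<Rightarrow> 'm) \<Rightarrow> bool" where
  "proper_action G T X \<phi> \<longleftrightarrow>
     (\<forall>D. compactin X D \<longrightarrow> compactin T {g \<in> carrier G. \<phi> g ` D \<inter> D \<noteq> {}})"

definition isometric_action ::
    "('g, 'e) monoid_scheme \<Rightarrow> 'm set \<Rightarrow> ('m \<Rightarrow> 'm \<Rightarrow> real) \<Rightarrow> ('g \<Rightarrow> 'm \<Rightarrow> 'm) \<Rightarrow> bool" where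
  "isometric_action G M d \<phi> \<longleftrightarrow>
     (\<forall>g \<in> carrier G. \<forall>x \<in> M. \<forall>y \<in> M. d (\<phi> g x) (\<phi> g y) = d x y)"

definition property_S ::
    "('g, 'e) monoid_scheme \<Rightarrow> 'm set \<Rightarrow> ('m \<Rightarrow> 'm \<Rightarrow> real) \<Rightarrow> ('g \<Rightarrow> 'm \<Rightarrow> 'm) \<Rightarrow> bool" where
  "property_S G M d \<phi> \<longleftrightarrow>
     (\<forall>r \<ge> 0. \<exists>\<tau> \<ge> 0. \<forall>p0 \<in> M. \<forall>p \<in> M. \<forall>q \<in> M. d p p0 \<le> r \<longrightarrow>
        (\<exists>g \<in> carrier G. \<phi> g p = p0 \<and> d q (\<phi> g q) \<le> \<tau>))"


section \<open>Subsets of a topological group\<close>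

definition relatively_compactin :: "'a topology \<Rightarrow> 'a set \<Rightarrow> bool" where
  "relatively_compactin T S \<longleftrightarrow> S \<subseteq> topspace T \<and> compactin T (T closure_of S)"

definition group_nbhd :: "('g, 'e) monoid_scheme \<Rightarrow> 'g set \<Rightarrow> 'g set \<Rightarrow> 'g set" where
  "group_nbhd G D H = D <#>\<^bsub>G\<^esub> H <#>\<^bsub>G\<^esub> (set_inv\<^bsub>G\<^esub> D)"

definition group_equiv :: "('g, 'e) monoid_scheme \<Rightarrow> 'g topology \<Rightarrow> 'g set \<Rightarrow> 'g set \<Rightarrow> bool" where
  "group_equiv G T H1 H2 \<longleftrightarrow>
     (\<exists>D. compactin T D \<and> H1 \<subseteq> group_nbhd G D H2 \<and> H2 \<subseteq> group_nbhd G D H1)"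

definition group_class :: "('g, 'e) monoid_scheme \<Rightarrow> 'g topology \<Rightarrow> 'g set \<Rightarrow> 'g set set" where
  "group_class G T H = {H'. H' \<subseteq> carrier G \<and> H' \<noteq> {} \<and> group_equiv G T H' H}"

definition proper_pair :: "('g, 'e) monoid_scheme \<Rightarrow> 'g topology \<Rightarrow> 'g set \<Rightarrow> 'g set \<Rightarrow> bool" where
  "proper_pair G T H1 H2 \<longleftrightarrow>
     (\<forall>H1' \<in> group_class G T H1. \<forall>H2' \<in> group_class G T H2. relatively_compactin T (H1' \<inter> H2'))"

definition proper_partners :: "('g, 'e) monoid_scheme \<Rightarrow> 'g topology \<Rightarrow> 'g set \<Rightarrow> 'g set set" where
  "proper_partners G T H = {H'. H' \<subseteq> carrier G \<and> H' \<noteq> {} \<and> proper_pair G T H H'}"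


section \<open>Subsets of a metric space\<close>

definition proper_metric_space :: "'a set \<Rightarrow> ('a \<Rightarrow> 'a \<Rightarrow> real) \<Rightarrow> bool" where
  "proper_metric_space X d \<longleftrightarrow> Metric_space X d \<and>
     (\<forall>x \<in> X. \<forall>r. compactin (Metric_space.mtopology X d) (Metric_space.mcball X d x r))"

definition metric_nbhd :: "'a set \<Rightarrow> ('a \<Rightarrow> 'a \<Rightarrow> real) \<Rightarrow> real \<Rightarrow> 'a set \<Rightarrow> 'a set" where
  "metric_nbhd X d r C = {p \<in> X. \<exists>c \<in> C. d p c \<le> r}"

definition metric_equiv :: "'a set \<Rightarrow> ('a \<Rightarrow> 'a \<Rightarrow> real) \<Rightarrow> 'a set \<Rightarrow> 'a set \<Rightarrow> bool" where
  "metric_equiv X d C1 C2 \<longleftrightarrow> (\<exists>r \<ge> 0. C1 \<subseteq> metric_nbhd X d r C2 \<and> C2 \<subseteq> metric_nbhd X d r C1)"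

definition metric_class :: "'a set \<Rightarrow> ('a \<Rightarrow> 'a \<Rightarrow> real) \<Rightarrow> 'a set \<Rightarrow> 'a set set" where
  "metric_class X d C = {C'. C' \<subseteq> X \<and> C' \<noteq> {} \<and> metric_equiv X d C' C}"

definition HBI_pair :: "'a set \<Rightarrow> ('a \<Rightarrow> 'a \<Rightarrow> real) \<Rightarrow> 'a set \<Rightarrow> 'a set \<Rightarrow> bool" where
  "HBI_pair X d C1 C2 \<longleftrightarrow>
     (\<forall>C1' \<in> metric_class X d C1. \<forall>C2' \<in> metric_class X d C2. Metric_space.mbounded X d (C1' \<inter> C2'))"

definition HBI_partners :: "'a set \<Rightarrow> ('a \<Rightarrow> 'a \<Rightarrow> real) \<Rightarrow> 'a set \<Rightarrow> 'a set set" where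
  "HBI_partners X d C = {C'. C' \<subseteq> X \<and> C' \<noteq> {} \<and> HBI_pair X d C C'}"


section \<open>The orbit space of a compact subgroup\<close>

definition orbit_space ::
    "('g, 'e) monoid_scheme \<Rightarrow> 'm set \<Rightarrow> ('g \<Rightarrow> 'm \<Rightarrow> 'm) \<Rightarrow> 'g set \<Rightarrow> 'm set set" where
  "orbit_space G M \<phi> K = orbits (G\<lparr>carrier := K\<rparr>) M \<phi>"

text \<open>The value \<open>0\<close> outside the orbit space is needed because the locale \<^locale>\<open>Metric_space\<close>
  requires a distance function to be non-negative and symmetric on the whole type. That the minimum
  is attained for orbits of a compact isotropy group is part of \<open>orbit_dist_attained\<close> below.\<close>

definition orbit_dist ::
    "('g, 'e) monoid_scheme \<Rightarrow> 'm set \<Rightarrow> ('m \<Rightarrow> 'm \<Rightarrow> real) \<Rightarrow> ('g \<Rightarrow> 'm \<Rightarrow> 'm) \<Rightarrow> 'g set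
      \<Rightarrow> 'm set \<Rightarrow> 'm set \<Rightarrow> real" where
  "orbit_dist G M d \<phi> K O1 O2 =
     (if O1 \<in> orbit_space G M \<phi> K \<and> O2 \<in> orbit_space G M \<phi> K
      then (LEAST t. \<exists>x \<in> O1. \<exists>y \<in> O2. t = d x y) else 0)"

definition orbit_proj ::
    "('g, 'e) monoid_scheme \<Rightarrow> ('g \<Rightarrow> 'm \<Rightarrow> 'm) \<Rightarrow> 'g set \<Rightarrow> 'm \<Rightarrow> 'g \<Rightarrow> 'm set" where
  "orbit_proj G \<phi> K b g = orbit (G\<lparr>carrier := K\<rparr>) \<phi> (\<phi> g b)"

lemma orbit_proj_in_orbit_space:
  assumes "group_action G M \<phi>" "b \<in> M" "g \<in> carrier G"
  shows "orbit_proj G \<phi> K b g \<in> orbit_space G M \<phi> K"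
  using group_action.element_image[OF assms(1,3,2)]
  unfolding orbit_proj_def orbit_space_def orbits_def by blast

lemma compactin_stabilizer:
  assumes "group_action G M \<phi>" "Metric_space M d" "b \<in> M"
    and "proper_action G T (Metric_space.mtopology M d) \<phi>"
  shows "compactin T (stabilizer G \<phi> b)"
proof -
  interpret Metric_space M d by fact
  have "compactin mtopology {b}" using assms(3) by simp
  then have "compactin T {g \<in> carrier G. \<phi> g ` {b} \<inter> {b} \<noteq> {}}"
    using assms(4) unfolding proper_action_def by blast
  moreover have "{g \<in> carrier G. \<phi> g ` {b} \<inter> {b} \<noteq> {}} = stabilizer G \<phi> b"
    unfolding stabilizer_def by auto
  ultimately show ?thesis by simp
qed

lemma compactin_orbit:
  assumes "Metric_space M d" "continuous_action T (Metric_space.mtopology M d) \<phi>"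
    and "compactin T K" "x \<in> M"
  shows "compactin (Metric_space.mtopology M d) (orbit (G\<lparr>carrier := K\<rparr>) \<phi> x)"
proof -
  interpret Metric_space M d by fact
  have "continuous_map T (prod_topology T mtopology) (\<lambda>g. (g, x))"
    using assms(4) by (simp add: continuous_map_pairwise o_def)
  from continuous_map_compose[OF this assms(2)[unfolded continuous_action_def]]
  have "continuous_map T mtopology (\<lambda>g. \<phi> g x)" by (simp add: o_def)
  with assms(3) have "compactin mtopology ((\<lambda>g. \<phi> g x) ` K)" by (rule image_compactin)
  moreover have "(\<lambda>g. \<phi> g x) ` K = orbit (G\<lparr>carrier := K\<rparr>) \<phi> x"
    unfolding orbit_def by auto
  ultimately show ?thesis by simp
qed

lemma orbit_dist_attained:
  fixes G (structure)
  assumes act: "group_action G M \<phi>" and met: "Metric_space M d"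
    and cont: "continuous_action T (Metric_space.mtopology M d) \<phi>"
    and isom: "isometric_action G M d \<phi>"
    and K: "subgroup K G" "compactin T K" and xy: "x \<in> M" "y \<in> M"
  defines "orb \<equiv> orbit (G\<lparr>carrier := K\<rparr>) \<phi>"
  shows "\<exists>k \<in> K. orbit_dist G M d \<phi> K (orb x) (orb y) = d x (\<phi> k y)"
    and "\<And>u v. u \<in> orb x \<Longrightarrow> v \<in> orb y \<Longrightarrow> orbit_dist G M d \<phi> K (orb x) (orb y) \<le> d u v"
proof -
  interpret Metric_space M d by fact
  interpret A: group_action G M \<phi> by fact
  interpret group G using A.group_hom group_hom.axioms(1) by blast
  have KG: "k \<in> carrier G" if "k \<in> K" for k using K(1) that by (rule subgroup.mem_carrier)
  have "compactin euclideanreal (d x ` orb y)"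
  proof (rule image_compactin)
    show "compactin mtopology (orb y)"
      unfolding orb_def by (rule compactin_orbit[OF met cont K(2) xy(2)])
    show "continuous_map mtopology euclideanreal (d x)"
      using continuous_on_mdist[of x Self] xy(1) by (simp add: Self_def)
  qed
  then have "compact (d x ` orb y)" by simp
  moreover have "\<phi> \<one> y \<in> orb y"
    unfolding orb_def orbit_def using subgroup.one_closed[OF K(1)] by auto
  ultimately obtain v0 where v0: "v0 \<in> orb y" "\<forall>v \<in> orb y. d x v0 \<le> d x v"
    using compact_attains_inf[of "d x ` orb y"] by blast
  then obtain k where k: "k \<in> K" "v0 = \<phi> k y"
    unfolding orb_def orbit_def by auto
  have le: "d x v0 \<le> d u v" if u: "u \<in> orb x" and v: "v \<in> orb y" for u v
  proof -
    obtain h where h: "h \<in> K" "u = \<phi> h x" using u unfolding orb_def orbit_def by auto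
    obtain l where l: "l \<in> K" "v = \<phi> l y" using v unfolding orb_def orbit_def by auto
    have hi: "inv h \<in> K" using h(1) K(1) by (simp add: subgroup.m_inv_closed)
    have uv: "u \<in> M" "v \<in> M" using h l xy KG A.element_image by blast+
    have "d u v = d (\<phi> (inv h) u) (\<phi> (inv h) v)"
      using isom uv KG[OF hi] unfolding isometric_action_def by simp
    also have "\<phi> (inv h) u = x" using A.orbit_sym_aux[OF KG[OF h(1)] xy(1)] h(2) by simp
    also have "\<phi> (inv h) v = \<phi> (inv h \<otimes> l) y"
      using A.composition_rule[OF xy(2) KG[OF hi] KG[OF l(1)]] l(2) by simp
    finally have "d u v = d x (\<phi> (inv h \<otimes> l) y)" .
    moreover have "\<phi> (inv h \<otimes> l) y \<in> orb y"
      unfolding orb_def orbit_def using subgroup.m_closed[OF K(1) hi l(1)] by auto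
    ultimately show ?thesis using v0(2) by simp
  qed
  have "\<phi> \<one> x = x" using A.id_eq_one xy(1) by (metis restrict_apply')
  then have x_in: "x \<in> orb x"
    unfolding orb_def orbit_def using subgroup.one_closed[OF K(1)] by force
  have "(LEAST t. \<exists>u \<in> orb x. \<exists>v \<in> orb y. t = d u v) = d x v0"
    by (rule Least_equality) (use x_in v0(1) le in auto)
  moreover have "orb x \<in> orbit_space G M \<phi> K" "orb y \<in> orbit_space G M \<phi> K"
    unfolding orb_def orbit_space_def orbits_def using xy by blast+
  ultimately have *: "orbit_dist G M d \<phi> K (orb x) (orb y) = d x v0"
    unfolding orbit_dist_def by simp
  show "\<exists>k \<in> K. orbit_dist G M d \<phi> K (orb x) (orb y) = d x (\<phi> k y)"
    using * k by blast
  show "orbit_dist G M d \<phi> K (orb x) (orb y) \<le> d u v" if "u \<in> orb x" "v \<in> orb y" for u v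
    using * le that by simp
qed

lemma proper_metric_space_orbit_space:
  assumes act: "group_action G M \<phi>" and pms: "proper_metric_space M d"
    and cont: "continuous_action T (Metric_space.mtopology M d) \<phi>"
    and isom: "isometric_action G M d \<phi>"
    and K: "subgroup K G" "compactin T K"
  shows "proper_metric_space (orbit_space G M \<phi> K) (orbit_dist G M d \<phi> K)"
proof -
  have met: "Metric_space M d" using pms unfolding proper_metric_space_def by blast
  interpret Metric_space M d by fact
  interpret A: group_action G M \<phi> by fact
  interpret group G using A.group_hom group_hom.axioms(1) by blast
  interpret AK: group_action "G\<lparr>carrier := K\<rparr>" M \<phi>
    by (rule A.induced_action[OF K(1)])
  define orb where "orb = orbit (G\<lparr>carrier := K\<rparr>) \<phi>"
  define Q where "Q = orbit_space G M \<phi> K"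
  define e where "e = orbit_dist G M d \<phi> K"
  note att = orbit_dist_attained[OF act met cont isom K, folded orb_def e_def]
  have KG: "k \<in> carrier G" if "k \<in> K" for k using K(1) that by (rule subgroup.mem_carrier)
  have Q: "Q = orb ` M" unfolding Q_def orbit_space_def orbits_def orb_def by auto
  have self: "x \<in> orb x" if "x \<in> M" for x
    using AK.orbit_refl[OF that] unfolding orb_def .
  have shift: "orb (\<phi> k x) = orb x" "\<phi> k x \<in> M" "\<phi> k x \<in> orb x" if "k \<in> K" "x \<in> M" for k x
  proof -
    show 1: "\<phi> k x \<in> M" using that KG A.element_image by blast
    show 2: "\<phi> k x \<in> orb x" using that unfolding orb_def orbit_def by auto
    have "x \<in> orb (\<phi> k x)"
      using AK.orbit_sym[OF that(2) 1] 2 unfolding orb_def by simp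
    moreover have "orb u \<subseteq> M" if "u \<in> M" for u
      using that AK.element_image unfolding orb_def orbit_def by blast
    ultimately show "orb (\<phi> k x) = orb x"
      using AK.orbit_trans[folded orb_def] 1 2 that(2) by blast
  qed
  have outside: "e O1 O2 = 0" if "\<not> (O1 \<in> Q \<and> O2 \<in> Q)" for O1 O2
    using that unfolding e_def orbit_dist_def Q_def by auto
  have metQ: "Metric_space Q e"
  proof
    show "0 \<le> e A B" for A B
    proof (cases "A \<in> Q \<and> B \<in> Q")
      case True
      then obtain x y where "x \<in> M" "y \<in> M" "A = orb x" "B = orb y"
        unfolding Q by auto
      then show ?thesis using att(1)[of x y] by auto
    qed (simp add: outside)
    show "e A B = e B A" for A B
    proof (cases "A \<in> Q \<and> B \<in> Q")
      case True
      have "(\<exists>x \<in> A. \<exists>y \<in> B. t = d x y) \<longleftrightarrow> (\<exists>x \<in> B. \<exists>y \<in> A. t = d x y)" for t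
        using commute by metis
      then show ?thesis using True unfolding e_def orbit_dist_def Q_def by simp
    qed (simp add: outside conj_commute)
    fix A B assume "A \<in> Q" "B \<in> Q"
    then obtain x y where xy: "x \<in> M" "y \<in> M" and AB: "A = orb x" "B = orb y"
      unfolding Q by auto
    obtain k where k: "k \<in> K" "e A B = d x (\<phi> k y)"
      using att(1)[OF xy] AB by auto
    have "A = B" if "e A B = 0"
      using that k shift[OF k(1) xy(2)] xy AB by auto
    moreover have "e A B = 0" if "A = B"
    proof -
      have "e A B \<le> d x x" using att(2)[OF xy, of x x] AB that self[OF xy(1)] by auto
      moreover have "d x x = 0" using xy(1) by simp
      ultimately show ?thesis using k(2) nonneg[of x "\<phi> k y"] by linarith
    qed
    ultimately show "(e A B = 0) = (A = B)" by blast
    fix C assume "C \<in> Q"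
    then obtain z where z: "z \<in> M" "C = orb z" unfolding Q by auto
    define y' where "y' = \<phi> k y"
    have y': "y' \<in> M" "B = orb y'" using shift[OF k(1) xy(2)] AB y'_def by auto
    obtain l where l: "l \<in> K" "e B C = d y' (\<phi> l z)"
      using att(1)[OF y'(1) z(1)] y'(2) z(2) by auto
    have "e A C \<le> d x (\<phi> l z)"
      using att(2)[OF xy(1) z(1) self[OF xy(1)] shift(3)[OF l(1) z(1)]] AB z by simp
    also have "\<dots> \<le> d x y' + d y' (\<phi> l z)"
      using triangle xy(1) y'(1) shift(2)[OF l(1) z(1)] by blast
    finally show "e A C \<le> e A B + e B C" using k l y'_def by simp
  qed
  interpret Q: Metric_space Q e by fact
  have lip: "e (orb x) (orb y) \<le> d x y" if "x \<in> M" "y \<in> M" for x y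
    using att(2) self that by simp
  have contp: "continuous_map mtopology Q.mtopology orb"
    unfolding metric_continuous_map[OF metQ]
  proof (intro conjI ballI allI impI)
    show "orb ` M \<subseteq> Q" using Q by simp
    fix a and \<epsilon> :: real assume "a \<in> M" "0 < \<epsilon>"
    then show "\<exists>\<delta>>0. \<forall>x. x \<in> M \<and> d a x < \<delta> \<longrightarrow> e (orb a) (orb x) < \<epsilon>"
      using lip by (meson le_less_trans)
  qed
  have "compactin Q.mtopology (Q.mcball A r)" if A: "A \<in> Q" for A r
  proof -
    obtain x where x: "x \<in> M" "A = orb x" using A Q by auto
    have "Q.mcball A r = orb ` mcball x r"
    proof
      show "orb ` mcball x r \<subseteq> Q.mcball A r"
      proof (rule image_subsetI)
        fix y assume "y \<in> mcball x r"
        then have "y \<in> M" "d x y \<le> r" by auto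
        moreover from this have "orb y \<in> Q" "e A (orb y) \<le> r"
          using Q lip[OF x(1), of y] x(2) by auto
        ultimately show "orb y \<in> Q.mcball A r" using A by simp
      qed
      show "Q.mcball A r \<subseteq> orb ` mcball x r"
      proof
        fix B assume B: "B \<in> Q.mcball A r"
        then have "B \<in> Q" "e A B \<le> r" by auto
        then obtain y where y: "y \<in> M" "B = orb y" using Q by auto
        obtain k where k: "k \<in> K" "e A B = d x (\<phi> k y)" using att(1)[OF x(1) y(1)] x y by auto
        then have "\<phi> k y \<in> mcball x r" "B = orb (\<phi> k y)"
          using \<open>e A B \<le> r\<close> shift[OF k(1) y(1)] x(1) y(2) by auto
        then show "B \<in> orb ` mcball x r" by blast
      qed
    qed
    then show ?thesis
      using pms x(1) image_compactin[OF _ contp] unfolding proper_metric_space_def by auto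
  qed
  then show ?thesis
    using metQ unfolding proper_metric_space_def Q_def e_def by blast
qed

end

theory Submission
  imports Defs
begin

text \<open>
  The map \<open>\<mu>\<close> turns the coarse structure of the group (closeness up to two-sided translation by a
  compact set) into the coarse structure of the metric space \<open>K\M\<close>; once this is known, every
  clause of the theorem is a statement about a single metric space.

  The dictionary rests on two inequalities, uniform in \<open>g\<close> and \<open>h\<close>. If the orbits \<open>\<mu> g\<close> and \<open>\<mu> h\<close> are
  at distance at most \<open>r\<close>, some \<open>k \<in> K\<close> brings \<open>k h b\<close> within \<open>r\<close> of \<open>g b\<close>, hence \<open>c = g\<inverse> k h\<close> moves the
  base point \<open>b\<close> by at most \<open>r\<close> and \<open>g = k h c\<inverse>\<close>; properness of the action makes the set of all elements
  that move \<open>b\<close> by at most \<open>r\<close> compact (\<open>near_orbits_imp_group_nbhd\<close>). Conversely let \<open>g = u h v\<inverse>\<close> with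
  \<open>u\<close>, \<open>v\<close> in a compact set, so that both move \<open>b\<close> by at most some \<open>r\<close>. The factor \<open>v\<inverse>\<close> costs at most
  \<open>r\<close> because the action is isometric, but left translation by \<open>u\<close> may displace the far away point
  \<open>h b\<close> a lot. Property (S) replaces \<open>u\<close> by an element of \<open>K\<close>, which is invisible in \<open>K\M\<close>, at the
  price of an error \<open>\<tau> r\<close> that depends on \<open>r\<close> only (\<open>group_nbhd_imp_near_orbits\<close>).

  Consequently \<open>H \<sim> H'\<close> in the group exactly when \<open>\<mu> ` H \<sim> \<mu> ` H'\<close>. As \<open>\<mu>\<close> is onto and a set of group
  elements is relatively compact exactly when its image is bounded, proper pairs correspond to HBI
  pairs, and the partners of \<open>H\<close> are the sets whose images are partners of \<open>\<mu> ` H\<close>.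

  What remains is that a subset of a metric space is determined up to \<open>\<sim>\<close> by its HBI partners
  (\<open>HBI_partners_eq_iff\<close>). If \<open>C1\<close> is contained in no neighbourhood of \<open>C2\<close>, a sequence in \<open>C1\<close> escaping
  from all neighbourhoods of \<open>C2\<close> is a partner of \<open>C2\<close>, whereas it cannot be a partner of \<open>C1\<close>,
  of which it is an unbounded subset.
\<close>

section \<open>Coarse geometry of a metric space\<close>

lemma (in Metric_space) metric_nbhd_trans:
  assumes "A \<subseteq> metric_nbhd M d r B" and "B \<subseteq> metric_nbhd M d s C" and "C \<subseteq> M"
  shows "A \<subseteq> metric_nbhd M d (r + s) C"
proof
  fix a assume "a \<in> A"
  then obtain x where x: "a \<in> M" "x \<in> B" "d a x \<le> r"
    using assms(1) unfolding metric_nbhd_def by blast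
  then obtain c where c: "x \<in> M" "c \<in> C" "d x c \<le> s"
    using assms(2) unfolding metric_nbhd_def by blast
  have "d a c \<le> d a x + d x c" using x c assms(3) triangle by blast
  with x c show "a \<in> metric_nbhd M d (r + s) C" unfolding metric_nbhd_def by force
qed

lemma (in Metric_space) metric_equiv_subset:
  "metric_equiv M d A B \<Longrightarrow> A \<subseteq> M" "metric_equiv M d A B \<Longrightarrow> B \<subseteq> M"
  unfolding metric_equiv_def metric_nbhd_def by blast+

lemma (in Metric_space) metric_equiv_refl: "A \<subseteq> M \<Longrightarrow> metric_equiv M d A A"
  unfolding metric_equiv_def metric_nbhd_def by (intro exI[of _ 0]) force

lemma metric_equiv_sym: "metric_equiv X d A B \<Longrightarrow> metric_equiv X d B A"
  unfolding metric_equiv_def by blast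

lemma (in Metric_space) metric_equiv_trans:
  assumes "metric_equiv M d A B" and "metric_equiv M d B C"
  shows "metric_equiv M d A C"
proof -
  obtain r where r: "0 \<le> r" "A \<subseteq> metric_nbhd M d r B" "B \<subseteq> metric_nbhd M d r A"
    using assms(1) unfolding metric_equiv_def by blast
  obtain s where s: "0 \<le> s" "B \<subseteq> metric_nbhd M d s C" "C \<subseteq> metric_nbhd M d s B"
    using assms(2) unfolding metric_equiv_def by blast
  have "A \<subseteq> metric_nbhd M d (r + s) C" "C \<subseteq> metric_nbhd M d (s + r) A"
    using metric_nbhd_trans[OF r(2) s(2) metric_equiv_subset(2)[OF assms(2)]]
      metric_nbhd_trans[OF s(3) r(3) metric_equiv_subset(1)[OF assms(1)]] by auto
  with r s show ?thesis
    unfolding metric_equiv_def by (intro exI[of _ "r + s"]) (simp add: add.commute)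
qed

lemma (in Metric_space) metric_class_cong:
  "metric_equiv M d A B \<Longrightarrow> metric_class M d A = metric_class M d B"
  unfolding metric_class_def by (metis metric_equiv_trans metric_equiv_sym)

lemma (in Metric_space) mbounded_metric_nbhd:
  assumes "mbounded A"
  shows "mbounded (metric_nbhd M d r A)"
proof -
  obtain x s where A: "A \<subseteq> mcball x s" using assms unfolding mbounded_def by blast
  have "metric_nbhd M d r A \<subseteq> mcball x (s + r)"
  proof
    fix p assume "p \<in> metric_nbhd M d r A"
    then obtain a where a: "p \<in> M" "a \<in> A" "d p a \<le> r" unfolding metric_nbhd_def by blast
    moreover have "x \<in> M" "a \<in> M" "d x a \<le> s" using A a by auto
    moreover have "d x p \<le> d x a + d a p" using triangle calculation by blast
    ultimately show "p \<in> mcball x (s + r)" by (simp add: commute[of a])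
  qed
  then show ?thesis unfolding mbounded_def by blast
qed

lemma (in Metric_space) HBI_pair_sym: "HBI_pair M d A B \<Longrightarrow> HBI_pair M d B A"
  unfolding HBI_pair_def by (metis Int_commute)

text \<open>
  It is enough to thicken one of the two sets: a point near both \<open>A\<close> and \<open>B\<close> is near a point of \<open>A\<close>
  that is itself near \<open>B\<close>.
\<close>

lemma (in Metric_space) HBI_pair_iff:
  assumes A: "A \<subseteq> M" "A \<noteq> {}" and B: "B \<subseteq> M" "B \<noteq> {}"
  shows "HBI_pair M d A B \<longleftrightarrow> (\<forall>r \<ge> 0. mbounded (A \<inter> metric_nbhd M d r B))"
proof
  assume H: "HBI_pair M d A B"
  show "\<forall>r \<ge> 0. mbounded (A \<inter> metric_nbhd M d r B)"
  proof (intro allI impI)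
    fix r :: real assume r: "0 \<le> r"
    have sub: "B \<subseteq> metric_nbhd M d r B" "B \<subseteq> metric_nbhd M d r (metric_nbhd M d r B)"
      using B r unfolding metric_nbhd_def by force+
    have "metric_nbhd M d r B \<in> metric_class M d B"
      unfolding metric_class_def metric_equiv_def
      using sub B r by (auto simp: metric_nbhd_def)
    moreover have "A \<in> metric_class M d A"
      using A metric_equiv_refl unfolding metric_class_def by blast
    ultimately show "mbounded (A \<inter> metric_nbhd M d r B)"
      using H unfolding HBI_pair_def by blast
  qed
next
  assume H: "\<forall>r \<ge> 0. mbounded (A \<inter> metric_nbhd M d r B)"
  show "HBI_pair M d A B" unfolding HBI_pair_def
  proof (intro ballI)
    fix A' B' assume "A' \<in> metric_class M d A" and "B' \<in> metric_class M d B"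
    then obtain r s where r: "0 \<le> r" "A' \<subseteq> metric_nbhd M d r A"
      and s: "0 \<le> s" "B' \<subseteq> metric_nbhd M d s B"
      unfolding metric_class_def metric_equiv_def by blast
    have "A' \<inter> B' \<subseteq> metric_nbhd M d r (A \<inter> metric_nbhd M d (r + s) B)"
    proof
      fix p assume p: "p \<in> A' \<inter> B'"
      then obtain a where a: "p \<in> M" "a \<in> A" "d p a \<le> r"
        using r unfolding metric_nbhd_def by blast
      have "{a} \<subseteq> metric_nbhd M d r {p}"
        using a A by (auto simp: metric_nbhd_def commute)
      moreover have "{p} \<subseteq> metric_nbhd M d s B" using p s by blast
      ultimately have "a \<in> metric_nbhd M d (r + s) B"
        using metric_nbhd_trans B(1) by blast
      with a show "p \<in> metric_nbhd M d r (A \<inter> metric_nbhd M d (r + s) B)"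
        unfolding metric_nbhd_def by blast
    qed
    moreover have "mbounded (A \<inter> metric_nbhd M d (r + s) B)" using H r s by simp
    ultimately show "mbounded (A' \<inter> B')"
      using mbounded_subset[OF mbounded_metric_nbhd] by metis
  qed
qed

text \<open>
  The points \<open>x n\<close> chosen in \<open>A\<close> outside the \<open>n\<close>-neighbourhood of \<open>B\<close> form a test set: each
  neighbourhood of \<open>B\<close> contains finitely many of them, although they are unbounded.
\<close>

lemma (in Metric_space) HBI_partners_subset_imp_metric_nbhd:
  assumes A: "A \<subseteq> M" "A \<noteq> {}" and B: "B \<subseteq> M" "B \<noteq> {}"
    and partners: "HBI_partners M d B \<subseteq> HBI_partners M d A"
  shows "\<exists>n::nat. A \<subseteq> metric_nbhd M d (real n) B"
proof (rule ccontr)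
  assume "\<not> ?thesis"
  then have "\<forall>n::nat. \<exists>p. p \<in> A \<and> p \<notin> metric_nbhd M d (real n) B" by blast
  then obtain x where x: "\<And>n::nat. x n \<in> A" "\<And>n. x n \<notin> metric_nbhd M d (real n) B"
    by metis
  have far: "real n < d (x n) c" if "c \<in> B" for n c
    using x(1)[of n] x(2)[of n] A(1) that unfolding metric_nbhd_def
    by (metis (mono_tags, lifting) mem_Collect_eq not_le subsetD)
  define C where "C = range x"
  have C: "C \<subseteq> A" "C \<subseteq> M" "C \<noteq> {}" using x(1) A(1) unfolding C_def by auto
  have "mbounded (C \<inter> metric_nbhd M d r B)" for r
  proof -
    have "C \<inter> metric_nbhd M d r B \<subseteq> x ` {n. real n \<le> r}"
    proof
      fix p assume "p \<in> C \<inter> metric_nbhd M d r B"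
      then obtain n c where "p = x n" "c \<in> B" "d p c \<le> r"
        unfolding C_def metric_nbhd_def by blast
      then show "p \<in> x ` {n. real n \<le> r}" using far[of c n] by auto
    qed
    moreover have "finite {n. real n \<le> r}"
    proof (rule finite_subset)
      show "{n. real n \<le> r} \<subseteq> {..nat \<lfloor>r\<rfloor>}" by (auto simp: le_nat_floor)
    qed simp
    ultimately have "finite (C \<inter> metric_nbhd M d r B)"
      using finite_subset finite_imageI by metis
    then show ?thesis
      using C by (intro compactin_imp_mbounded finite_imp_compactin) auto
  qed
  then have "C \<in> HBI_partners M d B"
    using HBI_pair_iff[OF C(2,3) B] HBI_pair_sym C unfolding HBI_partners_def by blast
  then have "HBI_pair M d A C" using partners unfolding HBI_partners_def by blast
  then have "mbounded (A \<inter> metric_nbhd M d 0 C)" using HBI_pair_iff[OF A C(2,3)] by simp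
  moreover have "C \<subseteq> A \<inter> metric_nbhd M d 0 C"
    using C unfolding metric_nbhd_def by force
  ultimately have "mbounded C" using mbounded_subset by blast
  obtain c where c: "c \<in> B" using B by blast
  have "mbounded (insert c C)" using \<open>mbounded C\<close> c B by (auto simp: mbounded_insert)
  then obtain s where s: "\<forall>p \<in> insert c C. \<forall>q \<in> insert c C. d p q \<le> s"
    unfolding mbounded_alt by blast
  have "d (x (nat \<lceil>s\<rceil>)) c \<le> s" using s unfolding C_def by auto
  then show False using far[OF c, of "nat \<lceil>s\<rceil>"] by linarith
qed

theorem (in Metric_space) HBI_partners_eq_iff:
  assumes A: "A \<subseteq> M" "A \<noteq> {}" and B: "B \<subseteq> M" "B \<noteq> {}"
  shows "HBI_partners M d A = HBI_partners M d B \<longleftrightarrow> metric_equiv M d A B"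
proof
  assume "metric_equiv M d A B"
  then show "HBI_partners M d A = HBI_partners M d B"
    unfolding HBI_partners_def HBI_pair_def by (simp add: metric_class_cong)
next
  assume eq: "HBI_partners M d A = HBI_partners M d B"
  obtain m n :: nat where "A \<subseteq> metric_nbhd M d (real m) B" "B \<subseteq> metric_nbhd M d (real n) A"
    using HBI_partners_subset_imp_metric_nbhd[OF A B] HBI_partners_subset_imp_metric_nbhd[OF B A]
      eq by blast
  moreover have "metric_nbhd M d (real m) C \<subseteq> metric_nbhd M d (real (m + n)) C"
    and "metric_nbhd M d (real n) C \<subseteq> metric_nbhd M d (real (m + n)) C" for C
    unfolding metric_nbhd_def by force+
  ultimately have "A \<subseteq> metric_nbhd M d (real (m + n)) B" "B \<subseteq> metric_nbhd M d (real (m + n)) A"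
    by (meson order_trans)+
  then show "metric_equiv M d A B"
    unfolding metric_equiv_def by (meson of_nat_0_le_iff)
qed


section \<open>Proper transitive isometric actions\<close>

lemma mem_group_nbhd_iff:
  "g \<in> group_nbhd G D H \<longleftrightarrow>
     (\<exists>u \<in> D. \<exists>h \<in> H. \<exists>v \<in> D. g = u \<otimes>\<^bsub>G\<^esub> h \<otimes>\<^bsub>G\<^esub> inv\<^bsub>G\<^esub> v)"
  unfolding group_nbhd_def set_mult_def SET_INV_def by blast

locale proper_homogeneous_space = topological_group G T + transitive_action G M \<phi>
  for G :: "('g, 'e) monoid_scheme" (structure) and T :: "'g topology"
    and M :: "'m set" and \<phi> :: "'g \<Rightarrow> 'm \<Rightarrow> 'm" +
  fixes d :: "'m \<Rightarrow> 'm \<Rightarrow> real" and b :: 'm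
  assumes proper_space: "proper_metric_space M d"
    and Hausdorff: "Hausdorff_space T"
    and cont: "continuous_action T (Metric_space.mtopology M d) \<phi>"
    and proper: "proper_action G T (Metric_space.mtopology M d) \<phi>"
    and isom: "isometric_action G M d \<phi>"
    and base: "b \<in> M"
begin

sublocale M: Metric_space M d
  using proper_space unfolding proper_metric_space_def by blast

definition "K = stabilizer G \<phi> b"
definition "Q = orbit_space G M \<phi> K"
definition "dK = orbit_dist G M d \<phi> K"
definition "\<mu> = orbit_proj G \<phi> K b"

lemma subgroup_K: "subgroup K G"
  unfolding K_def by (rule stabilizer_subgroup[OF base])

lemma compactin_K: "compactin T K"
  unfolding K_def
  by (rule compactin_stabilizer[OF group_action_axioms M.Metric_space_axioms base proper])

sublocale Q: Metric_space Q dK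
  using proper_metric_space_orbit_space[OF group_action_axioms proper_space cont isom
      subgroup_K compactin_K]
  unfolding proper_metric_space_def Q_def dK_def by blast

lemma K_iff: "k \<in> K \<longleftrightarrow> k \<in> carrier G \<and> \<phi> k b = b"
  unfolding K_def stabilizer_def by auto

lemma act_closed: "g \<in> carrier G \<Longrightarrow> x \<in> M \<Longrightarrow> \<phi> g x \<in> M"
  using element_image by blast

lemma act_mult: "g \<in> carrier G \<Longrightarrow> h \<in> carrier G \<Longrightarrow> x \<in> M \<Longrightarrow> \<phi> (g \<otimes> h) x = \<phi> g (\<phi> h x)"
  using composition_rule by simp

lemma act_one: "x \<in> M \<Longrightarrow> \<phi> \<one> x = x"
  using id_eq_one by (metis restrict_apply')

lemma act_isometric:
  "g \<in> carrier G \<Longrightarrow> x \<in> M \<Longrightarrow> y \<in> M \<Longrightarrow> d (\<phi> g x) (\<phi> g y) = d x y"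
  using isom unfolding isometric_action_def by blast

lemma displacement_inv:
  assumes g: "g \<in> carrier G"
  shows "d (\<phi> (inv g) b) b = d (\<phi> g b) b"
proof -
  have "d (\<phi> (inv g) b) b = d (\<phi> g (\<phi> (inv g) b)) (\<phi> g b)"
    using act_isometric g base act_closed by simp
  also have "\<phi> g (\<phi> (inv g) b) = b"
    using act_mult[of g "inv g" b] g base act_one by simp
  finally show ?thesis by (simp add: M.commute)
qed

text \<open>
  These sets play in the group the part that the balls around \<open>\<mu> \<one>\<close> play in the orbit space: they are
  compact, and every compact set lies in one of them. They replace compact sets by numbers.
\<close>

definition displacement_ball :: "real \<Rightarrow> 'g set" where
  "displacement_ball r = {g \<in> carrier G. d (\<phi> g b) b \<le> r}"

lemma continuous_map_orbit: "continuous_map T M.mtopology (\<lambda>g. \<phi> g b)"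
proof -
  have "continuous_map T (prod_topology T M.mtopology) (\<lambda>g. (g, b))"
    using base by (simp add: continuous_map_pairwise o_def)
  from continuous_map_compose[OF this cont[unfolded continuous_action_def]]
  show ?thesis by (simp add: o_def)
qed

lemma compactin_displacement_ball:
  assumes r: "0 \<le> r"
  shows "compactin T (displacement_ball r)"
proof -
  let ?B = "M.mcball b r"
  have "compactin T {g \<in> carrier G. \<phi> g ` ?B \<inter> ?B \<noteq> {}}"
    using proper proper_space base unfolding proper_action_def proper_metric_space_def by blast
  moreover have eq: "displacement_ball r = {g \<in> topspace T. \<phi> g b \<in> ?B}"
    unfolding displacement_ball_def topspace_eq_carrier
    using base act_closed by (auto simp: M.commute)
  have "displacement_ball r \<subseteq> {g \<in> carrier G. \<phi> g ` ?B \<inter> ?B \<noteq> {}}"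
  proof
    fix g assume g: "g \<in> displacement_ball r"
    then have "\<phi> g b \<in> \<phi> g ` ?B \<inter> ?B" using eq base r by auto
    then show "g \<in> {g \<in> carrier G. \<phi> g ` ?B \<inter> ?B \<noteq> {}}"
      using g unfolding displacement_ball_def by blast
  qed
  moreover have "closedin T (displacement_ball r)"
    unfolding eq
    by (rule closedin_continuous_map_preimage[OF continuous_map_orbit M.closedin_mcball])
  ultimately show ?thesis using closed_compactin by blast
qed

lemma compactin_imp_displacement_ball:
  assumes D: "compactin T D"
  obtains r where "0 \<le> r" "D \<subseteq> displacement_ball r"
proof -
  have "compactin M.mtopology ((\<lambda>g. \<phi> g b) ` D)"
    using image_compactin[OF D continuous_map_orbit] .
  then have "M.mbounded (insert b ((\<lambda>g. \<phi> g b) ` D))"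
    using base by (auto simp: M.mbounded_insert M.compactin_imp_mbounded)
  then obtain r where r: "\<forall>x \<in> insert b ((\<lambda>g. \<phi> g b) ` D).
      \<forall>y \<in> insert b ((\<lambda>g. \<phi> g b) ` D). d x y \<le> r"
    unfolding M.mbounded_alt by blast
  then have "d b b \<le> r" by blast
  then have "0 \<le> r" using base by simp
  moreover have "D \<subseteq> displacement_ball r"
    using r compactin_subset_topspace[OF D]
    unfolding displacement_ball_def topspace_eq_carrier by auto
  ultimately show ?thesis using that by blast
qed

lemma relatively_compactin_iff_displacement_ball:
  "relatively_compactin T S \<longleftrightarrow> (\<exists>r \<ge> 0. S \<subseteq> displacement_ball r)"
proof
  assume S: "relatively_compactin T S"
  then have "S \<subseteq> T closure_of S" and "compactin T (T closure_of S)"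
    unfolding relatively_compactin_def by (simp_all add: closure_of_subset)
  then show "\<exists>r \<ge> 0. S \<subseteq> displacement_ball r"
    using compactin_imp_displacement_ball by (metis subset_trans)
next
  assume "\<exists>r \<ge> 0. S \<subseteq> displacement_ball r"
  then obtain r where r: "0 \<le> r" "S \<subseteq> displacement_ball r" by blast
  note compact = compactin_displacement_ball[OF r(1)]
  have "closedin T (displacement_ball r)"
    using compactin_imp_closedin[OF Hausdorff compact] .
  then have "T closure_of S \<subseteq> displacement_ball r" using closure_of_minimal r(2) by blast
  then show "relatively_compactin T S"
    unfolding relatively_compactin_def
    using closed_compactin[OF compact _ closedin_closure_of] r(2)
      compactin_subset_topspace[OF compact] by blast
qed


section \<open>The projection to the orbit space\<close>

lemma \<mu>_in_Q: "g \<in> carrier G \<Longrightarrow> \<mu> g \<in> Q"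
  unfolding \<mu>_def Q_def by (rule orbit_proj_in_orbit_space[OF group_action_axioms base])

lemma image_\<mu>_subset: "H \<subseteq> carrier G \<Longrightarrow> \<mu> ` H \<subseteq> Q"
  using \<mu>_in_Q by blast

lemma \<mu>_surj: "\<mu> ` carrier G = Q"
proof
  show "Q \<subseteq> \<mu> ` carrier G"
  proof
    fix A assume "A \<in> Q"
    then obtain x where x: "x \<in> M" "A = orbit (G\<lparr>carrier := K\<rparr>) \<phi> x"
      unfolding Q_def orbit_space_def orbits_def by blast
    obtain g where "g \<in> carrier G" "\<phi> g b = x" using unique_orbit[OF base x(1)] by blast
    then show "A \<in> \<mu> ` carrier G" using x unfolding \<mu>_def orbit_proj_def by blast
  qed
qed (rule image_\<mu>_subset[OF order_refl])

lemma \<mu>_dist_attained: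
  assumes "g \<in> carrier G" "h \<in> carrier G"
  obtains k where "k \<in> K" "dK (\<mu> g) (\<mu> h) = d (\<phi> g b) (\<phi> (k \<otimes> h) b)"
proof -
  obtain k where "k \<in> K" "dK (\<mu> g) (\<mu> h) = d (\<phi> g b) (\<phi> k (\<phi> h b))"
    using orbit_dist_attained(1)[OF group_action_axioms M.Metric_space_axioms cont isom
        subgroup_K compactin_K act_closed[OF assms(1) base] act_closed[OF assms(2) base]]
    unfolding \<mu>_def dK_def orbit_proj_def by blast
  moreover have "\<phi> k (\<phi> h b) = \<phi> (k \<otimes> h) b" if "k \<in> K" for k
    using act_mult that assms base by (simp add: K_iff)
  ultimately show ?thesis using that by simp
qed

lemma \<mu>_dist_le:
  assumes "g \<in> carrier G" "h \<in> carrier G" "k \<in> K"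
  shows "dK (\<mu> g) (\<mu> h) \<le> d (\<phi> g b) (\<phi> (k \<otimes> h) b)"
  unfolding \<mu>_def dK_def orbit_proj_def
proof (rule orbit_dist_attained(2)[OF group_action_axioms M.Metric_space_axioms cont isom
        subgroup_K compactin_K act_closed[OF assms(1) base] act_closed[OF assms(2) base]])
  show "\<phi> g b \<in> orbit (G\<lparr>carrier := K\<rparr>) \<phi> (\<phi> g b)"
    unfolding orbit_def
    using act_one act_closed assms base subgroup.one_closed[OF subgroup_K] by force
  show "\<phi> (k \<otimes> h) b \<in> orbit (G\<lparr>carrier := K\<rparr>) \<phi> (\<phi> h b)"
    unfolding orbit_def using act_mult assms base by (auto simp: K_iff)
qed

text \<open>
  As \<open>K\<close> fixes the base point, the orbit \<open>\<mu> \<one>\<close> is a single point and no minimum has to be taken. Hence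
  the displacement balls are the preimages of the balls around \<open>\<mu> \<one>\<close>.
\<close>

lemma \<mu>_dist_one:
  assumes "g \<in> carrier G"
  shows "dK (\<mu> g) (\<mu> \<one>) = d (\<phi> g b) b"
proof -
  obtain k where "k \<in> K" "dK (\<mu> g) (\<mu> \<one>) = d (\<phi> g b) (\<phi> (k \<otimes> \<one>) b)"
    using \<mu>_dist_attained[OF assms one_closed] .
  then show ?thesis by (simp add: K_iff)
qed

lemma relatively_compactin_iff_mbounded:
  assumes S: "S \<subseteq> carrier G"
  shows "relatively_compactin T S \<longleftrightarrow> Q.mbounded (\<mu> ` S)"
proof
  assume "relatively_compactin T S"
  then obtain r where "S \<subseteq> displacement_ball r"
    using relatively_compactin_iff_displacement_ball by blast
  then have "\<mu> ` S \<subseteq> Q.mcball (\<mu> \<one>) r"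
    using \<mu>_in_Q \<mu>_dist_one by (auto simp: displacement_ball_def Q.commute)
  then show "Q.mbounded (\<mu> ` S)" unfolding Q.mbounded_def by blast
next
  assume "Q.mbounded (\<mu> ` S)"
  then have "Q.mbounded (insert (\<mu> \<one>) (\<mu> ` S))"
    using \<mu>_in_Q by (auto simp: Q.mbounded_insert)
  then obtain r where r: "\<forall>x \<in> insert (\<mu> \<one>) (\<mu> ` S). \<forall>y \<in> insert (\<mu> \<one>) (\<mu> ` S). dK x y \<le> r"
    unfolding Q.mbounded_alt by blast
  then have "dK (\<mu> \<one>) (\<mu> \<one>) \<le> r" by blast
  then have "0 \<le> r" using \<mu>_in_Q by simp
  moreover have "S \<subseteq> displacement_ball r"
  proof
    fix g assume g: "g \<in> S"
    then have "dK (\<mu> g) (\<mu> \<one>) \<le> r" using r by blast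
    with g S show "g \<in> displacement_ball r"
      using \<mu>_dist_one unfolding displacement_ball_def by auto
  qed
  ultimately show "relatively_compactin T S"
    using relatively_compactin_iff_displacement_ball by blast
qed

text \<open>
  If \<open>k h b\<close> lies within \<open>r\<close> of \<open>g b\<close>, then \<open>c = g\<inverse> k h\<close> moves \<open>b\<close> by at most \<open>r\<close>, and \<open>g = k h c\<inverse>\<close>.
\<close>

lemma near_orbits_imp_group_nbhd:
  assumes r: "0 \<le> r" and g: "g \<in> carrier G" and H: "H \<subseteq> carrier G"
    and near: "\<mu> g \<in> metric_nbhd Q dK r (\<mu> ` H)"
  shows "g \<in> group_nbhd G (displacement_ball r) H"
proof -
  obtain h where h: "h \<in> H" "dK (\<mu> g) (\<mu> h) \<le> r" using near unfolding metric_nbhd_def by blast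
  have hG: "h \<in> carrier G" using h H by blast
  obtain k where k: "k \<in> K" "dK (\<mu> g) (\<mu> h) = d (\<phi> g b) (\<phi> (k \<otimes> h) b)"
    using \<mu>_dist_attained[OF g hG] .
  have kG: "k \<in> carrier G" using k K_iff by blast
  define c where "c = inv g \<otimes> (k \<otimes> h)"
  have c: "c \<in> carrier G" "g \<otimes> c = k \<otimes> h"
    unfolding c_def using g kG hG by (simp_all flip: m_assoc)
  have "d (\<phi> c b) b = d (\<phi> g (\<phi> c b)) (\<phi> g b)"
    using act_isometric g c base act_closed by simp
  also have "\<dots> = d (\<phi> g b) (\<phi> (k \<otimes> h) b)"
    using act_mult[OF g c(1) base] c(2) M.commute by simp
  finally have "c \<in> displacement_ball r"
    using h k c unfolding displacement_ball_def by simp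
  moreover have "k \<in> displacement_ball r"
    using k r base unfolding displacement_ball_def K_iff by simp
  moreover have "g = k \<otimes> h \<otimes> inv c"
    using c g kG hG by (metis inv_solve_right m_closed)
  ultimately show ?thesis using h unfolding mem_group_nbhd_iff by blast
qed

text \<open>
  Property (S), applied to the points \<open>p = u b\<close>, \<open>p0 = b\<close> and \<open>q = u h b\<close>, yields \<open>w\<close> with \<open>w u \<in> K\<close>
  that moves \<open>u h b\<close> by at most \<open>\<tau> r\<close>. Modulo \<open>K\<close> the left factor \<open>u\<close> therefore costs \<open>\<tau> r\<close>,
  however large \<open>h\<close> is.
\<close>

lemma group_nbhd_imp_near_orbits:
  assumes S: "property_S G M d \<phi>" and D: "compactin T D"
  shows "\<exists>R \<ge> 0. \<forall>H. H \<subseteq> carrier G \<longrightarrow> \<mu> ` group_nbhd G D H \<subseteq> metric_nbhd Q dK R (\<mu> ` H)"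
proof -
  obtain r where r: "0 \<le> r" "D \<subseteq> displacement_ball r"
    using compactin_imp_displacement_ball[OF D] .
  obtain t where t: "0 \<le> t" "\<forall>p0 \<in> M. \<forall>p \<in> M. \<forall>q \<in> M. d p p0 \<le> r \<longrightarrow>
      (\<exists>g \<in> carrier G. \<phi> g p = p0 \<and> d q (\<phi> g q) \<le> t)"
    using S r(1) unfolding property_S_def by blast
  have "\<mu> g \<in> metric_nbhd Q dK (r + t) (\<mu> ` H)"
    if H: "H \<subseteq> carrier G" and nbhd: "g \<in> group_nbhd G D H" for g H
  proof -
    obtain u h v where uhv: "u \<in> D" "h \<in> H" "v \<in> D" "g = u \<otimes> h \<otimes> inv v"
      using nbhd unfolding mem_group_nbhd_iff by blast
    have G: "u \<in> carrier G" "v \<in> carrier G" "h \<in> carrier G"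
      and disp: "d (\<phi> u b) b \<le> r" "d (\<phi> v b) b \<le> r"
      using uhv r H unfolding displacement_ball_def by auto
    have gG: "g \<in> carrier G" using uhv G by simp
    define q where "q = \<phi> (u \<otimes> h) b"
    have q: "q \<in> M" unfolding q_def using G base act_closed by simp
    obtain w where w: "w \<in> carrier G" "\<phi> w (\<phi> u b) = b" "d q (\<phi> w q) \<le> t"
      using t(2) disp(1) G base act_closed q by blast
    have wu: "w \<otimes> u \<in> K" using w G base act_mult by (simp add: K_iff)
    have "\<phi> w q = \<phi> (w \<otimes> u \<otimes> h) b"
      unfolding q_def using w G base act_mult[of w "u \<otimes> h" b] by (simp add: m_assoc)
    then have "dK (\<mu> g) (\<mu> h) \<le> d (\<phi> g b) (\<phi> w q)"
      using \<mu>_dist_le[OF gG G(3) wu] by simp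
    also have "\<dots> \<le> d (\<phi> g b) q + d q (\<phi> w q)"
      using M.triangle act_closed gG base q w by simp
    also have "d (\<phi> g b) q = d (\<phi> (inv v) b) b"
      unfolding q_def uhv(4) using G base act_closed act_mult[of "u \<otimes> h" "inv v" b]
      by (simp add: act_isometric)
    finally have "dK (\<mu> g) (\<mu> h) \<le> r + t"
      using displacement_inv[OF G(2)] disp(2) w(3) by simp
    then show ?thesis
      using uhv(2) \<mu>_in_Q[OF gG] unfolding metric_nbhd_def by blast
  qed
  then show ?thesis using r t by (intro exI[of _ "r + t"]) auto
qed

end


section \<open>Transfer between the group and the orbit space\<close>

locale property_S_space = proper_homogeneous_space +
  assumes property_S: "property_S G M d \<phi>"
begin

lemma group_equiv_iff_metric_equiv:
  assumes H: "H1 \<subseteq> carrier G" "H2 \<subseteq> carrier G"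
  shows "group_equiv G T H1 H2 \<longleftrightarrow> metric_equiv Q dK (\<mu> ` H1) (\<mu> ` H2)"
proof
  assume "group_equiv G T H1 H2"
  then obtain D where D: "compactin T D" "H1 \<subseteq> group_nbhd G D H2" "H2 \<subseteq> group_nbhd G D H1"
    unfolding group_equiv_def by blast
  obtain R where R: "0 \<le> R"
    and near: "\<forall>H. H \<subseteq> carrier G \<longrightarrow> \<mu> ` group_nbhd G D H \<subseteq> metric_nbhd Q dK R (\<mu> ` H)"
    using group_nbhd_imp_near_orbits[OF property_S D(1)] by blast
  have "\<mu> ` H1 \<subseteq> metric_nbhd Q dK R (\<mu> ` H2)" "\<mu> ` H2 \<subseteq> metric_nbhd Q dK R (\<mu> ` H1)"
    using near H image_mono[OF D(2)] image_mono[OF D(3)] by (meson order_trans)+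
  then show "metric_equiv Q dK (\<mu> ` H1) (\<mu> ` H2)"
    using R unfolding metric_equiv_def by blast
next
  assume "metric_equiv Q dK (\<mu> ` H1) (\<mu> ` H2)"
  then obtain r where r: "0 \<le> r" "\<mu> ` H1 \<subseteq> metric_nbhd Q dK r (\<mu> ` H2)"
    "\<mu> ` H2 \<subseteq> metric_nbhd Q dK r (\<mu> ` H1)"
    unfolding metric_equiv_def by blast
  have "H1 \<subseteq> group_nbhd G (displacement_ball r) H2"
    by (rule subsetI, rule near_orbits_imp_group_nbhd[OF r(1)]) (use r(2) H in auto)
  moreover have "H2 \<subseteq> group_nbhd G (displacement_ball r) H1"
    by (rule subsetI, rule near_orbits_imp_group_nbhd[OF r(1)]) (use r(3) H in auto)
  ultimately show "group_equiv G T H1 H2"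
    using compactin_displacement_ball[OF r(1)] unfolding group_equiv_def by blast
qed

lemma group_class_iff_metric_class:
  assumes "H \<subseteq> carrier G" "H' \<subseteq> carrier G"
  shows "H' \<in> group_class G T H \<longleftrightarrow> \<mu> ` H' \<in> metric_class Q dK (\<mu> ` H)"
  unfolding group_class_def metric_class_def
  using group_equiv_iff_metric_equiv assms image_\<mu>_subset by simp

lemma subset_Q_eq_image:
  assumes "C \<subseteq> Q"
  shows "\<mu> ` {g \<in> carrier G. \<mu> g \<in> C} = C"
  using assms unfolding \<mu>_surj[symmetric] by blast

text \<open>
  Preimages carry representatives of the classes in \<open>Q\<close> to representatives of the classes in the
  group, and images carry them back; boundedness of an intersection and relative compactness
  correspond along the way.
\<close>

lemma proper_pair_iff_HBI_pair:
  assumes H: "H1 \<subseteq> carrier G" "H2 \<subseteq> carrier G"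
  shows "proper_pair G T H1 H2 \<longleftrightarrow> HBI_pair Q dK (\<mu> ` H1) (\<mu> ` H2)"
proof
  assume proper: "proper_pair G T H1 H2"
  show "HBI_pair Q dK (\<mu> ` H1) (\<mu> ` H2)" unfolding HBI_pair_def
  proof (intro ballI)
    fix C1 C2 assume C: "C1 \<in> metric_class Q dK (\<mu> ` H1)" "C2 \<in> metric_class Q dK (\<mu> ` H2)"
    \<comment> \<open>Full preimages are chosen so that the image of the intersection is all of \<open>C1 \<inter> C2\<close>.\<close>
    define P where "P C = {g \<in> carrier G. \<mu> g \<in> C}" for C
    have sub: "C1 \<subseteq> Q" "C2 \<subseteq> Q" using C unfolding metric_class_def by auto
    have P: "P C \<subseteq> carrier G" "C \<subseteq> Q \<Longrightarrow> \<mu> ` P C = C" "P C1 \<inter> P C2 = P (C1 \<inter> C2)" for C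
      using subset_Q_eq_image unfolding P_def by auto
    have "P C1 \<in> group_class G T H1" "P C2 \<in> group_class G T H2"
      using C sub H P(1,2) by (simp_all add: group_class_iff_metric_class)
    then have "relatively_compactin T (P (C1 \<inter> C2))"
      using proper P(3) unfolding proper_pair_def by metis
    then have "Q.mbounded (\<mu> ` P (C1 \<inter> C2))"
      using relatively_compactin_iff_mbounded P(1) by blast
    then show "Q.mbounded (C1 \<inter> C2)" using P(2)[of "C1 \<inter> C2"] sub by (metis le_infI1)
  qed
next
  assume HBI: "HBI_pair Q dK (\<mu> ` H1) (\<mu> ` H2)"
  show "proper_pair G T H1 H2" unfolding proper_pair_def
  proof (intro ballI)
    fix H1' H2' assume H': "H1' \<in> group_class G T H1" "H2' \<in> group_class G T H2"
    have sub: "H1' \<subseteq> carrier G" "H2' \<subseteq> carrier G" using H' unfolding group_class_def by auto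
    then have "Q.mbounded (\<mu> ` H1' \<inter> \<mu> ` H2')"
      using HBI H' H group_class_iff_metric_class unfolding HBI_pair_def by blast
    then have "Q.mbounded (\<mu> ` (H1' \<inter> H2'))"
      by (rule Q.mbounded_subset) blast
    then show "relatively_compactin T (H1' \<inter> H2')"
      using relatively_compactin_iff_mbounded sub by blast
  qed
qed

lemma proper_partners_iff_HBI_partners:
  assumes "H \<subseteq> carrier G" "H' \<subseteq> carrier G"
  shows "H' \<in> proper_partners G T H \<longleftrightarrow> \<mu> ` H' \<in> HBI_partners Q dK (\<mu> ` H)"
  unfolding proper_partners_def HBI_partners_def
  using proper_pair_iff_HBI_pair assms image_\<mu>_subset by simp

lemma proper_partners_eq_iff:
  assumes H: "H1 \<subseteq> carrier G" "H2 \<subseteq> carrier G"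
  shows "proper_partners G T H1 = proper_partners G T H2 \<longleftrightarrow>
    HBI_partners Q dK (\<mu> ` H1) = HBI_partners Q dK (\<mu> ` H2)"
proof
  assume eq: "proper_partners G T H1 = proper_partners G T H2"
  have "C \<in> HBI_partners Q dK (\<mu> ` H1) \<longleftrightarrow> C \<in> HBI_partners Q dK (\<mu> ` H2)" if "C \<subseteq> Q" for C
  proof -
    let ?P = "{g \<in> carrier G. \<mu> g \<in> C}"
    have "?P \<subseteq> carrier G" by blast
    from proper_partners_iff_HBI_partners[OF H(1) this]
      proper_partners_iff_HBI_partners[OF H(2) this]
    show ?thesis by (simp only: eq subset_Q_eq_image[OF that])
  qed
  moreover have "C \<subseteq> Q" if "C \<in> HBI_partners Q dK A" for A C
    using that unfolding HBI_partners_def by blast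
  ultimately show "HBI_partners Q dK (\<mu> ` H1) = HBI_partners Q dK (\<mu> ` H2)" by blast
next
  assume eq: "HBI_partners Q dK (\<mu> ` H1) = HBI_partners Q dK (\<mu> ` H2)"
  have "H' \<in> proper_partners G T H1 \<longleftrightarrow> H' \<in> proper_partners G T H2"
    if "H' \<subseteq> carrier G" for H'
    by (simp only: proper_partners_iff_HBI_partners[OF H(1) that]
        proper_partners_iff_HBI_partners[OF H(2) that] eq)
  moreover have "H' \<subseteq> carrier G" if "H' \<in> proper_partners G T H" for H H'
    using that unfolding proper_partners_def by blast
  ultimately show "proper_partners G T H1 = proper_partners G T H2"
    by blast
qed

end


section \<open>Properness and equivalence through the orbit space\<close>

theorem theorem2p8:
  fixes G :: "('g, 'e) monoid_scheme" and T :: "'g topology"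
    and M :: "'m set" and d :: "'m \<Rightarrow> 'm \<Rightarrow> real"
    and \<phi> :: "'g \<Rightarrow> 'm \<Rightarrow> 'm" and b :: 'm
    and K :: "'g set" and Q :: "'m set set" and dK :: "'m set \<Rightarrow> 'm set \<Rightarrow> real"
    and \<mu> :: "'g \<Rightarrow> 'm set" and H1 H2 :: "'g set"
  assumes "proper_metric_space M d"
    and "topological_group G T"
    and "locally_compact_space T"
    and "Hausdorff_space T"
    and "transitive_action G M \<phi>"
    and "continuous_action T (Metric_space.mtopology M d) \<phi>"
    and "proper_action G T (Metric_space.mtopology M d) \<phi>"
    and "isometric_action G M d \<phi>"
    and "property_S G M d \<phi>"
    and "b \<in> M"
    and "K = stabilizer G \<phi> b"
    and "Q = orbit_space G M \<phi> K"
    and "dK = orbit_dist G M d \<phi> K"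
    and "\<mu> = orbit_proj G \<phi> K b"
    and "H1 \<subseteq> carrier G" and "H1 \<noteq> {}"
    and "H2 \<subseteq> carrier G" and "H2 \<noteq> {}"
  shows
    "((proper_pair G T H1 H2 \<longleftrightarrow> HBI_pair Q dK (\<mu> ` H1) (\<mu> ` H2)) \<and>
      (HBI_pair Q dK (\<mu> ` H1) (\<mu> ` H2) \<longleftrightarrow>
         (\<forall>r \<ge> 0. Metric_space.mbounded Q dK (\<mu> ` H1 \<inter> metric_nbhd Q dK r (\<mu> ` H2))))) \<and>
     ((group_equiv G T H1 H2 \<longleftrightarrow> metric_equiv Q dK (\<mu> ` H1) (\<mu> ` H2)) \<and>
      (group_equiv G T H1 H2 \<longleftrightarrow> proper_partners G T H1 = proper_partners G T H2) \<and>
      (group_equiv G T H1 H2 \<longleftrightarrow>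
         HBI_partners Q dK (\<mu> ` H1) = HBI_partners Q dK (\<mu> ` H2)))"
proof -
  interpret property_S_space G T M \<phi> d b
    using assms by (simp add: property_S_space_def property_S_space_axioms_def
        proper_homogeneous_space_def proper_homogeneous_space_axioms_def)
  have eqs: "K = local.K" "Q = local.Q" "dK = local.dK" "\<mu> = local.\<mu>"
    using assms by (simp_all add: K_def Q_def dK_def \<mu>_def)
  note H = \<open>H1 \<subseteq> carrier G\<close> \<open>H2 \<subseteq> carrier G\<close>
  have ne: "local.\<mu> ` H1 \<noteq> {}" "local.\<mu> ` H2 \<noteq> {}"
    using \<open>H1 \<noteq> {}\<close> \<open>H2 \<noteq> {}\<close> by simp_all
  note sub = image_\<mu>_subset[OF H(1)] image_\<mu>_subset[OF H(2)]
  show ?thesis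
    unfolding eqs
    using proper_pair_iff_HBI_pair[OF H] Q.HBI_pair_iff[OF sub(1) ne(1) sub(2) ne(2)]
      group_equiv_iff_metric_equiv[OF H] proper_partners_eq_iff[OF H]
      Q.HBI_partners_eq_iff[OF sub(1) ne(1) sub(2) ne(2)]
    by blast
qed

end
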